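(* Let $F$ be a field and let $U,V$ be $n\times n$ matrices over $F$ with $UV=I_n$; denote the rows of $U$ by $e_0,\ldots,e_{n-1}$. Let $E_0,E_1,\ldots,E_s$ be pairwise distinct $r\times n$ matrices, each $E_i$ consisting of $k$ rows of $U$, for some $1\le k\le r$ (depending on $i$), together with $r-k$ zero rows, and suppose that $E_0$ has rank $r$. Let $$G[z]=E_0+E_1z+\cdots+E_sz^s ,$$ and suppose that $e_j\in E_0$ implies $e_j\notin E_i$ for all $i\ne 0$. Then $G[z]$ is a noncatastrophic generator matrix for a convolutional $(n,r)$ code.
   Context: $e_j\in E_i$ means that $e_j$ is one of the rows of the matrix $E_i$; $e_j\notin E_i$ means it is not. A convolutional $(n,r)$ code over $F$ is the $F[z]$-submodule $\{u(z)G[z]:u(z)\in F[z]^r\}$ of $F[z]^n$ for a generator matrix $G[z]\in F[z]^{r\times n}$ of rank $r$. $G[z]$ is noncatastrophic if it has a polynomial right inverse, i.e. there is a polynomial $n\times r$ matrix $H[z]$ of rank $r$ with $G[z]H[z]=I_r$. *)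

theory Defs
  imports Jordan_Normal_Form.DL_Rank "HOL-Computational_Algebra.Polynomial_Factorial"
begin

(* The library rank takes the column dimension over a field and is parametrised by the
   number of rows (the length of the columns). *)
abbreviation mrank :: "'a::field mat \<Rightarrow> nat" where
  "mrank A \<equiv> vec_space.rank (dim_row A) A"

(* Rank of a polynomial matrix: its rank over the field of rational functions F(z). *)
definition poly_rank :: "'a::field poly mat \<Rightarrow> nat" where
  "poly_rank A = mrank (map_mat to_fract A)"

(* The set of u G with u a row vector; vectors are orientation-free, so u G is written
   as the transpose of G applied to u. *)
definition row_module :: "'a::field poly mat \<Rightarrow> 'a poly vec set" where
  "row_module G = {transpose_mat G *\<^sub>v u | u. u \<in> carrier_vec (dim_row G)}"

definition generator_matrix_for ::
    "nat \<Rightarrow> nat \<Rightarrow> 'a::field poly mat \<Rightarrow> 'a poly vec set \<Rightarrow> bool" where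
  "generator_matrix_for n r G C \<longleftrightarrow>
     G \<in> carrier_mat r n \<and> poly_rank G = r \<and> C = row_module G"

definition convolutional_code :: "nat \<Rightarrow> nat \<Rightarrow> 'a::field poly vec set \<Rightarrow> bool" where
  "convolutional_code n r C \<longleftrightarrow> (\<exists>G. generator_matrix_for n r G C)"

definition noncatastrophic :: "'a::field poly mat \<Rightarrow> bool" where
  "noncatastrophic G \<longleftrightarrow>
     (\<exists>H \<in> carrier_mat (dim_col G) (dim_row G).
        poly_rank H = dim_row G \<and> G * H = 1\<^sub>m (dim_row G))"

(* E consists of k rows of U, sitting at the positions in S in arbitrary order, together
   with zero rows at the remaining positions.  The k rows are not required to be distinct. *)
definition consists_of_rows :: "'a::field mat \<Rightarrow> nat \<Rightarrow> 'a mat \<Rightarrow> bool" where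
  "consists_of_rows U k E \<longleftrightarrow>
     (\<exists>S \<subseteq> {..<dim_row E}. card S = k \<and>
        (\<forall>a \<in> S. row E a \<in> set (rows U)) \<and>
        (\<forall>a \<in> {..<dim_row E} - S. row E a = 0\<^sub>v (dim_col E)))"

(* E 0 + E 1 z + ... + E s z^s, entrywise since matrices with varying dimensions do not
   form an additive monoid in which sum could be used. *)
definition poly_mat :: "nat \<Rightarrow> nat \<Rightarrow> (nat \<Rightarrow> 'a::field mat) \<Rightarrow> nat \<Rightarrow> 'a poly mat" where
  "poly_mat r n E s = mat r n (\<lambda>(a, b). \<Sum>i\<le>s. monom (E i $$ (a, b)) i)"

end

theory Submission
  imports Defs
begin

text \<open>Since \<open>E\<^sub>0\<close> has rank \<open>r\<close>, its rows are \<open>r\<close> distinct rows \<open>f(a)\<close> of \<open>U\<close>.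
  The constant matrix \<open>B\<close> whose columns are the columns \<open>f(a)\<close> of \<open>V\<close> satisfies \<open>E\<^sub>0 B = I\<close>, and
  \<open>E\<^sub>i B = 0\<close> for \<open>i > 0\<close> because \<open>E\<^sub>i\<close> contains none of these rows.  Hence \<open>B\<close> is
  a right inverse of \<open>G[z]\<close>, and both ranks are read off from the equation \<open>G[z] B = I\<close>.\<close>

text \<open>The column space is the image of \<open>x \<mapsto> A x\<close>. Rank \<open>m\<close>
  makes this map onto, so each system \<open>A x = unit_vec m i\<close> is solvable, and the
  solutions are the columns of \<open>B\<close>. Conversely, \<open>y = A (B y)\<close> puts every
  \<open>y\<close> in the image.\<close>

lemma rank_eq_dim_row_iff_right_inverse:
  fixes A :: "'a::field mat"
  assumes A: "A \<in> carrier_mat m n"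
  shows "vec_space.rank m A = m \<longleftrightarrow> (\<exists>B \<in> carrier_mat n m. A * B = 1\<^sub>m m)"
proof -
  interpret vec_space "TYPE('a)" m .
  have cols: "set (cols A) \<subseteq> carrier_vec m"
    using A cols_dim by blast
  have span: "span (set (cols A)) = {y \<in> carrier_vec m. \<exists>x \<in> carrier_vec n. A *\<^sub>v x = y}"
    using col_space_eq[OF A] A by (simp add: col_space_def)
  show ?thesis
  proof
    assume rank: "rank A = m"
    \<comment> \<open>A maximal independent set of columns has as many elements as the rank, here
      \<open>m\<close>, which is also the dimension of the whole space. It is therefore a basis, and
      the columns span.\<close>
    obtain S where S: "maximal S (\<lambda>T. T \<subseteq> set (cols A) \<and> lin_indpt T)"
      using maximal_exists_superset[of "set (cols A)" "\<lambda>T. T \<subseteq> set (cols A) \<and> lin_indpt T" "{}"]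
      by (auto simp: lin_dep_def)
    have "card S = m" "S \<subseteq> set (cols A)" "lin_indpt S"
      using rank_card_indpt[OF A S] rank S by (auto simp: maximal_def)
    then have "basis S"
      using cols dim_is_n by (intro dim_li_is_basis finite_subset[OF _ List.finite_set]) auto
    then have "carrier_vec m \<subseteq> span (set (cols A))"
      using span_is_monotone[OF \<open>S \<subseteq> set (cols A)\<close>] by (auto simp: basis_def)
    then have "unit_vec m i \<in> span (set (cols A))" for i
      by (rule subsetD) (rule unit_vec_carrier)
    then have "\<forall>i<m. \<exists>x \<in> carrier_vec n. A *\<^sub>v x = unit_vec m i"
      unfolding span by blast
    then obtain x where x: "\<And>i. i < m \<Longrightarrow> x i \<in> carrier_vec n \<and> A *\<^sub>v x i = unit_vec m i"
      by metis
    define B where "B = mat_of_cols n (map x [0..<m])"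
    have B: "B \<in> carrier_mat n m"
      using mat_of_cols_carrier(1)[of n "map x [0..<m]"] by (simp add: B_def)
    have "A * B = 1\<^sub>m m"
    proof (rule mat_col_eqI)
      fix i assume "i < dim_col (1\<^sub>m m :: 'a mat)"
      then have i: "i < m" by simp
      then have "col B i = x i"
        using x by (simp add: B_def)
      then show "col (A * B) i = col (1\<^sub>m m) i"
        using col_mult2[OF A B i] x i by simp
    qed (use A B in auto)
    with B show "\<exists>B \<in> carrier_mat n m. A * B = 1\<^sub>m m" by blast
  next
    assume "\<exists>B \<in> carrier_mat n m. A * B = 1\<^sub>m m"
    then obtain B where B: "B \<in> carrier_mat n m" and AB: "A * B = 1\<^sub>m m" by blast
    have "\<exists>x \<in> carrier_vec n. A *\<^sub>v x = y" if "y \<in> carrier_vec m" for y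
      using that assoc_mult_mat_vec[OF A B that] AB B
      by (intro bexI[of _ "B *\<^sub>v y"]) auto
    then have "span_vs (set (cols A)) = V"
      unfolding span by (auto simp: module_vec_def)
    then show "rank A = m"
      unfolding rank_def using dim_is_n by simp
  qed
qed

text \<open>The left inverse \<open>A\<close> makes \<open>B\<close> injective:
  \<open>B v = 0\<close> gives \<open>v = A (B v) = 0\<close>, so the columns of \<open>B\<close>
  are independent.\<close>

lemma rank_eq_dim_col_if_left_inverse:
  fixes A B :: "'a::field mat"
  assumes A: "A \<in> carrier_mat m n" and B: "B \<in> carrier_mat n m" and AB: "A * B = 1\<^sub>m m"
  shows "vec_space.rank n B = m"
proof -
  interpret vec_space "TYPE('a)" n .
  \<comment> \<open>Independence of \<open>set (cols B)\<close> does not see repeated columns, so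
    these are excluded first: \<open>A\<close> sends different columns to different unit
    vectors.\<close>
  have "distinct (cols B)"
  proof (subst distinct_conv_nth, intro allI impI)
    fix i j assume ij: "i < length (cols B)" "j < length (cols B)" "i \<noteq> j"
    then have "i < m" "j < m" using B by auto
    then have "A *\<^sub>v col B i = unit_vec m i" "A *\<^sub>v col B j = unit_vec m j"
      using col_mult2[OF A B] AB by auto
    moreover have "(unit_vec m i :: 'a vec) \<noteq> unit_vec m j"
      using \<open>i < m\<close> \<open>j < m\<close> \<open>i \<noteq> j\<close> by simp
    ultimately show "cols B ! i \<noteq> cols B ! j"
      using ij by auto
  qed
  moreover have "lin_indpt (set (cols B))"
  proof
    assume "lin_dep (set (cols B))"
    from lin_depE[OF B this \<open>distinct (cols B)\<close>] obtain v
      where v: "v \<in> carrier_vec m" "v \<noteq> 0\<^sub>v m" "B *\<^sub>v v = 0\<^sub>v n" .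
    then show False
      using assoc_mult_mat_vec[OF A B v(1)] AB A by (auto simp: scalar_prod_def)
  qed
  ultimately show ?thesis
    using lin_indpt_full_rank[OF B] by blast
qed

text \<open>The homomorphism \<open>to_fract\<close> carries the equation \<open>G * H = 1\<close>
  into the field of rational functions, where \<open>G\<close> has a right inverse and
  \<open>H\<close> a left inverse.\<close>

lemma poly_rank_if_mult_eq_one:
  fixes G H :: "'a::field poly mat"
  assumes G: "G \<in> carrier_mat m n" and H: "H \<in> carrier_mat n m" and GH: "G * H = 1\<^sub>m m"
  shows "poly_rank G = m" and "poly_rank H = m"
proof -
  interpret semiring_hom "to_fract :: 'a poly \<Rightarrow> _"
    by unfold_locales (auto simp: to_fract_add to_fract_mult)
  have G': "map_mat to_fract G \<in> carrier_mat m n" and H': "map_mat to_fract H \<in> carrier_mat n m"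
    using G H by auto
  have GH': "map_mat to_fract G * map_mat to_fract H = 1\<^sub>m m"
    using mat_hom_mult[OF G H] GH by (simp add: mat_hom_one)
  show "poly_rank G = m"
    using rank_eq_dim_row_iff_right_inverse[OF G'] H' GH' G by (auto simp: poly_rank_def)
  show "poly_rank H = m"
    using rank_eq_dim_col_if_left_inverse[OF G' H' GH'] H by (simp add: poly_rank_def)
qed

text \<open>A constant factor does not mix powers of \<open>z\<close>, so the product can be taken
  coefficient by coefficient.\<close>

lemma poly_mat_mult_const:
  fixes E :: "nat \<Rightarrow> 'a::field mat"
  assumes E: "\<And>i. i \<le> s \<Longrightarrow> E i \<in> carrier_mat r n" and B: "B \<in> carrier_mat n m"
  shows "poly_mat r n E s * map_mat (\<lambda>c. [:c:]) B = poly_mat r m (\<lambda>i. E i * B) s"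
proof (rule eq_matI)
  fix a b assume "a < dim_row (poly_mat r m (\<lambda>i. E i * B) s)" "b < dim_col (poly_mat r m (\<lambda>i. E i * B) s)"
  then have a: "a < r" and b: "b < m" by (auto simp: poly_mat_def)
  have "(poly_mat r n E s * map_mat (\<lambda>c. [:c:]) B) $$ (a, b)
      = (\<Sum>j<n. (\<Sum>i\<le>s. monom (E i $$ (a, j)) i) * [:B $$ (j, b):])"
    using a b B by (simp add: poly_mat_def scalar_prod_def lessThan_atLeast0)
  also have "\<dots> = (\<Sum>i\<le>s. \<Sum>j<n. monom (E i $$ (a, j) * B $$ (j, b)) i)"
  proof -
    have "monom c i * [:d:] = monom (c * d) i" for c d :: 'a and i
      by (simp add: smult_monom mult.commute)
    then show ?thesis
      by (simp only: sum_distrib_right) (rule sum.swap)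
  qed
  also have "\<dots> = (\<Sum>i\<le>s. monom ((E i * B) $$ (a, b)) i)"
  proof (rule sum.cong[OF refl])
    fix i assume "i \<in> {..s}"
    then have "E i \<in> carrier_mat r n" using E by simp
    then show "(\<Sum>j<n. monom (E i $$ (a, j) * B $$ (j, b)) i) = monom ((E i * B) $$ (a, b)) i"
      using a b B by (simp add: scalar_prod_def lessThan_atLeast0 monom_sum)
  qed
  finally show "(poly_mat r n E s * map_mat (\<lambda>c. [:c:]) B) $$ (a, b)
      = poly_mat r m (\<lambda>i. E i * B) s $$ (a, b)"
    using a b by (simp add: poly_mat_def)
qed (use B in \<open>auto simp: poly_mat_def\<close>)

theorem lemma2p1:
  fixes U V :: "'a::field mat"
    and E :: "nat \<Rightarrow> 'a mat"
    and n r s :: nat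
  assumes "U \<in> carrier_mat n n" and "V \<in> carrier_mat n n"
    and "U * V = 1\<^sub>m n"
    and "\<And>i. i \<le> s \<Longrightarrow> E i \<in> carrier_mat r n"
    and "inj_on E {..s}"
    and "\<And>i. i \<le> s \<Longrightarrow> \<exists>k. 1 \<le> k \<and> k \<le> r \<and> consists_of_rows U k (E i)"
    and "mrank (E 0) = r"
    and "\<And>j i. j < n \<Longrightarrow> row U j \<in> set (rows (E 0)) \<Longrightarrow> i \<le> s \<Longrightarrow> i \<noteq> 0
           \<Longrightarrow> row U j \<notin> set (rows (E i))"
  shows "(\<exists>C. convolutional_code n r C \<and> generator_matrix_for n r (poly_mat r n E s) C)
         \<and> noncatastrophic (poly_mat r n E s)"
proof -
  note U = assms(1) and V = assms(2) and UV = assms(3) and E = assms(4)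
  have row_cases: "row (E i) a = 0\<^sub>v n \<or> (\<exists>j<n. row (E i) a = row U j)"
    if i: "i \<le> s" and a: "a < r" for i a
  proof -
    obtain k where "consists_of_rows U k (E i)"
      using assms(6)[OF i] by blast
    then have "row (E i) a \<in> set (rows U) \<or> row (E i) a = 0\<^sub>v n"
      using E[OF i] a by (auto simp: consists_of_rows_def)
    then show ?thesis
      using U by (auto simp: rows_def)
  qed
  have row_U_V: "row U i \<bullet> col V j = (if i = j then 1 else 0)" if "i < n" "j < n" for i j
    using arg_cong[OF UV, of "\<lambda>M. M $$ (i, j)"] that U V by simp
  have E0: "E 0 \<in> carrier_mat r n" using E by simp
  \<comment> \<open>\<open>W\<close> turns the rank of \<open>E 0\<close> into scalar products of
    rows: a zero row, or two equal rows at different positions, would contradict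
    \<open>E 0 * W = 1\<close>.\<close>
  obtain W where W: "W \<in> carrier_mat n r" and EW: "E 0 * W = 1\<^sub>m r"
    using rank_eq_dim_row_iff_right_inverse[OF E0] assms(7) E0 by auto
  have row_E0_W: "row (E 0) a \<bullet> col W b = (if a = b then 1 else 0)" if "a < r" "b < r" for a b
    using arg_cong[OF EW, of "\<lambda>M. M $$ (a, b)"] that E0 W by simp
  have "row (E 0) a \<noteq> 0\<^sub>v n" if "a < r" for a
    using row_E0_W[OF that that] W that by auto
  then obtain f where f: "\<And>a. a < r \<Longrightarrow> f a < n \<and> row (E 0) a = row U (f a)"
    using row_cases[of 0] by (metis le0)
  \<comment> \<open>If \<open>f a = f b\<close>, rows \<open>a\<close> and \<open>b\<close> of
    \<open>E 0\<close> coincide, so their products with column \<open>b\<close> of \<open>W\<close>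
    agree. For \<open>a \<noteq> b\<close> these would be 0 and 1.\<close>
  have f_inj: "a = b" if "a < r" "b < r" "f a = f b" for a b
    using row_E0_W[of a b] row_E0_W[of b b] f that by (metis zero_neq_one)
  define B where "B = mat n r (\<lambda>(i, a). V $$ (i, f a))"
  have B: "B \<in> carrier_mat n r" by (simp add: B_def)
  have col_B: "col B a = col V (f a)" if "a < r" for a
    using that f V by (intro eq_vecI) (auto simp: B_def)
  \<comment> \<open>Entry \<open>(a, b)\<close> is \<open>row U (f a) \<bullet> col V (f b)\<close>,
    which is 1 exactly if \<open>f a = f b\<close>; injectivity of \<open>f\<close> turns this into
    \<open>a = b\<close>.\<close>
  have EB_0: "E 0 * B = 1\<^sub>m r"
    by (rule eq_matI) (use E0 B col_B f f_inj row_U_V in auto)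
  have EB_pos: "E i * B = 0\<^sub>m r r" if i: "i \<le> s" "i \<noteq> 0" for i
  proof (rule eq_matI)
    fix a b assume "a < dim_row (0\<^sub>m r r :: 'a mat)" "b < dim_col (0\<^sub>m r r :: 'a mat)"
    then have a: "a < r" and b: "b < r" by auto
    have "row (E 0) b \<in> set (rows (E 0))" "row (E i) a \<in> set (rows (E i))"
      using E0 E[OF i(1)] a b by (metis carrier_matD(1) in_set_conv_nth length_rows nth_rows)+
    then have "row (E i) a \<noteq> row U (f b)"
      using assms(8)[OF _ _ i, of "f b"] f[OF b] by metis
    \<comment> \<open>The row is zero or some \<open>row U j\<close>; in the latter case
      \<open>j \<noteq> f b\<close>, and \<open>U * V = 1\<close> makes the product an off-diagonal
      entry.\<close>
    then have "row (E i) a \<bullet> col V (f b) = 0"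
      using row_cases[OF i(1) a] row_U_V f[OF b] V by auto
    then show "(E i * B) $$ (a, b) = 0\<^sub>m r r $$ (a, b)"
      using E[OF i(1)] B a b col_B by simp
  qed (use E[OF i(1)] B in auto)
  define G where "G = poly_mat r n E s"
  define H where "H = map_mat (\<lambda>c. [:c:]) B"
  have G: "G \<in> carrier_mat r n" and H: "H \<in> carrier_mat n r"
    using B by (auto simp: G_def H_def poly_mat_def)
  have "G * H = poly_mat r r (\<lambda>i. E i * B) s"
    unfolding G_def H_def using E B by (rule poly_mat_mult_const)
  also have "\<dots> = 1\<^sub>m r"
  proof (rule eq_matI)
    fix a b assume "a < dim_row (1\<^sub>m r :: 'a poly mat)" "b < dim_col (1\<^sub>m r :: 'a poly mat)"
    then have a: "a < r" and b: "b < r" by auto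
    \<comment> \<open>Only the coefficient of \<open>z^0\<close> survives, so the product is a
      constant matrix.\<close>
    have "(\<Sum>i\<le>s. monom ((E i * B) $$ (a, b)) i)
        = (\<Sum>i\<le>s. if i = 0 then monom ((1\<^sub>m r) $$ (a, b)) 0 else 0)"
      by (rule sum.cong) (use EB_0 EB_pos a b in auto)
    then show "poly_mat r r (\<lambda>i. E i * B) s $$ (a, b) = 1\<^sub>m r $$ (a, b)"
      using a b by (simp add: poly_mat_def one_mat_def monom_0)
  qed (auto simp: poly_mat_def)
  finally have GH: "G * H = 1\<^sub>m r" .
  have "generator_matrix_for n r G (row_module G)"
    using G poly_rank_if_mult_eq_one(1)[OF G H GH] by (simp add: generator_matrix_for_def)
  moreover have "noncatastrophic G"
    unfolding noncatastrophic_def using G H GH poly_rank_if_mult_eq_one(2)[OF G H GH]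
    by (intro bexI[of _ H]) auto
  ultimately show ?thesis
    by (auto simp: G_def convolutional_code_def)
qed

end
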